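(* Let $K \subset K'$ be an algebraic separable field extension (with $K'$ inside the fixed algebraic closure $\overline{K}$ of $K$). Then the following are equivalent: (i) $K'$ can be generated over $K$ by a set of monomials lying in some $S_m$; that is, there exist a positive integer $m$ not divisible by $\mathrm{char}(k)$ and a set $P$ of monomials $X_1^{i_1/m}\cdots X_r^{i_r/m} \in S_m$ (with $i_1,\dots,i_r$ non-negative integers) such that $K' = K(P)$; (ii) there exist a positive integer $m$ not divisible by $\mathrm{char}(k)$ and a Puiseux power series $\zeta \in S_m$ such that $K' = K[\zeta]$.
   Context: $k$ is an algebraically closed field of arbitrary characteristic, $X_1,\dots,X_r$ are indeterminates formally independent over $k$, and $K = k((X_1,\dots,X_r))$ is the field of fractions of the formal power series ring $R = k[[X_1,\dots,X_r]]$. An algebraic closure $\overline{K}$ of $K$ is fixed, together with compatible roots $X_i^{1/m}$ (i.e. $(X_i^{1/(mq)})^q = X_i^{1/m}$). For a positive integer $m$ not divisible by $\mathrm{char}(k)$ (no condition if $\mathrm{char}(k)=0$), $S_m = k[[X_1^{1/m},\dots,X_r^{1/m}]]$ and $L_m = k((X_1^{1/m},\dots,X_r^{1/m}))$ is its field of fractions, viewed inside $\overline{K}$. Elements of $S_m$ are called Puiseux power series. $K[\zeta]$ denotes the extension of $K$ generated by $\zeta$ (it is a field, since $\zeta$ is algebraic over $K$). *)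

theory Defs
  imports
    "HOL-Computational_Algebra.Computational_Algebra"
    "HOL-Library.Function_Algebras"
    "HOL-Library.FuncSet"
begin

section \<open>Formal power series in finitely many indeterminates\<close>

text \<open>
  The indeterminates are indexed by a finite type \<open>'r\<close>, so their number is the arbitrary
  positive integer \<open>CARD('r)\<close>. A power series is given by its coefficients at the exponent
  vectors \<open>e :: 'r \<Rightarrow> nat\<close>.
\<close>

typedef ('k, 'r) mfps = "UNIV :: (('r \<Rightarrow> nat) \<Rightarrow> 'k) set"
  morphisms mfps_coeff Abs_mfps ..

setup_lifting type_definition_mfps

lemma mfps_eqI: "(\<And>e. mfps_coeff f e = mfps_coeff g e) \<Longrightarrow> f = g"
  by (simp add: mfps_coeff_inject[symmetric] fun_eq_iff)

lemma mfps_coeff_Abs [simp]: "mfps_coeff (Abs_mfps c) = c"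
  by (simp add: Abs_mfps_inverse)

definition splits :: "('r \<Rightarrow> nat) \<Rightarrow> (('r \<Rightarrow> nat) \<times> ('r \<Rightarrow> nat)) set" where
  "splits e = {(a, b). a + b = e}"

lemma finite_exponent_box: "finite {a :: 'r::finite \<Rightarrow> nat. \<forall>i. a i \<le> n i}"
proof -
  have "{a. \<forall>i. a i \<le> n i} = PiE UNIV (\<lambda>i. {..n i})"
    by auto
  then show ?thesis
    by (simp add: finite_PiE)
qed

lemma finite_splits [simp, intro]: "finite (splits (e :: 'r::finite \<Rightarrow> nat))"
proof -
  have "splits e \<subseteq> {a. \<forall>i. a i \<le> e i} \<times> {a. \<forall>i. a i \<le> e i}"
    by (auto simp: splits_def)
  then show ?thesis
    by (rule finite_subset) (simp add: finite_exponent_box)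
qed

instantiation mfps :: (comm_ring_1, finite) comm_ring_1
begin

lift_definition zero_mfps :: "('a, 'b) mfps" is "\<lambda>_. 0" .
lift_definition one_mfps :: "('a, 'b) mfps" is "\<lambda>e. if e = 0 then 1 else 0" .
lift_definition plus_mfps :: "('a, 'b) mfps \<Rightarrow> ('a, 'b) mfps \<Rightarrow> ('a, 'b) mfps"
  is "\<lambda>f g e. f e + g e" .
lift_definition minus_mfps :: "('a, 'b) mfps \<Rightarrow> ('a, 'b) mfps \<Rightarrow> ('a, 'b) mfps"
  is "\<lambda>f g e. f e - g e" .
lift_definition uminus_mfps :: "('a, 'b) mfps \<Rightarrow> ('a, 'b) mfps"
  is "\<lambda>f e. - f e" .
lift_definition times_mfps :: "('a, 'b) mfps \<Rightarrow> ('a, 'b) mfps \<Rightarrow> ('a, 'b) mfps"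
  is "\<lambda>f g e. \<Sum>(a, b)\<in>splits e. f a * g b" .

instance
proof
  fix f g h :: "('a, 'b) mfps"
  show "f * g * h = f * (g * h)"
  proof transfer
    fix f g h :: "('b \<Rightarrow> nat) \<Rightarrow> 'a"
    show "(\<lambda>e. \<Sum>(a, b)\<in>splits e. (\<Sum>(p, q)\<in>splits a. f p * g q) * h b) =
          (\<lambda>e. \<Sum>(a, b)\<in>splits e. f a * (\<Sum>(p, q)\<in>splits b. g p * h q))"
    proof
      fix e :: "'b \<Rightarrow> nat"
      have "(\<Sum>(a, b)\<in>splits e. (\<Sum>(p, q)\<in>splits a. f p * g q) * h b) =
            (\<Sum>(x, y)\<in>(SIGMA x:splits e. splits (fst x)). f (fst y) * g (snd y) * h (snd x))"
        by (subst sum.Sigma[symmetric])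
           (auto simp: sum_distrib_right case_prod_unfold intro!: sum.cong)
      also have "\<dots> = (\<Sum>(x, y)\<in>(SIGMA x:splits e. splits (snd x)). f (fst x) * (g (fst y) * h (snd y)))"
        by (rule sum.reindex_bij_witness[where
              i = "\<lambda>((a, b), (p, q)). ((a + p, q), (a, p))" and
              j = "\<lambda>((a, b), (p, q)). ((p, q + b), (q, b))"])
           (auto simp: splits_def add.assoc mult.assoc)
      also have "\<dots> = (\<Sum>(a, b)\<in>splits e. f a * (\<Sum>(p, q)\<in>splits b. g p * h q))"
        by (subst sum.Sigma[symmetric])
           (auto simp: sum_distrib_left case_prod_unfold intro!: sum.cong)
      finally show "(\<Sum>(a, b)\<in>splits e. (\<Sum>(p, q)\<in>splits a. f p * g q) * h b) =
          (\<Sum>(a, b)\<in>splits e. f a * (\<Sum>(p, q)\<in>splits b. g p * h q))" .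
    qed
  qed
  show "f * g = g * f"
  proof transfer
    fix f g :: "('b \<Rightarrow> nat) \<Rightarrow> 'a"
    show "(\<lambda>e. \<Sum>(a, b)\<in>splits e. f a * g b) = (\<lambda>e. \<Sum>(a, b)\<in>splits e. g a * f b)"
      by (intro ext sum.reindex_bij_witness[where i = prod.swap and j = prod.swap])
         (auto simp: splits_def add.commute mult.commute)
  qed
  show "1 * f = f"
  proof transfer
    fix f :: "('b \<Rightarrow> nat) \<Rightarrow> 'a"
    show "(\<lambda>e. \<Sum>(a, b)\<in>splits e. (if a = 0 then 1 else 0) * f b) = f"
    proof
      fix e :: "'b \<Rightarrow> nat"
      have "(\<Sum>(a, b)\<in>splits e. (if a = 0 then 1 else 0) * f b) =
            (\<Sum>(a, b)\<in>{(0 :: 'b \<Rightarrow> nat, e)}. (if a = 0 then 1 else 0) * f b)"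
        by (intro sum.mono_neutral_right finite_splits) (auto simp: splits_def split: if_splits)
      then show "(\<Sum>(a, b)\<in>splits e. (if a = 0 then 1 else 0) * f b) = f e"
        by simp
    qed
  qed
  show "(f + g) * h = f * h + g * h"
    by transfer (auto simp: fun_eq_iff sum.distrib[symmetric] algebra_simps intro!: sum.cong)
  show "(0 :: ('a, 'b) mfps) \<noteq> 1"
    by transfer (auto simp: fun_eq_iff)
qed (transfer, simp add: fun_eq_iff algebra_simps)+

end

lemma unique_leading_split:
  fixes A B :: "('r \<Rightarrow> nat) set"
  assumes "finite S" "A \<noteq> {}" "B \<noteq> {}"
  shows "\<exists>a\<in>A. \<exists>b\<in>B. \<forall>a'\<in>A. \<forall>b'\<in>B. a' + b' = a + b \<longrightarrow> (\<forall>i\<in>S. a' i = a i \<and> b' i = b i)"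
  using assms
proof (induction S arbitrary: A B rule: finite_induct)
  case empty
  then show ?case by auto
next
  case (insert x S)
  define u where "u = (LEAST n. n \<in> (\<lambda>a. a x) ` A)"
  define v where "v = (LEAST n. n \<in> (\<lambda>a. a x) ` B)"
  have u: "u \<in> (\<lambda>a. a x) ` A" "\<And>a. a \<in> A \<Longrightarrow> u \<le> a x"
    unfolding u_def using insert.prems by (auto intro: LeastI Least_le)
  have v: "v \<in> (\<lambda>a. a x) ` B" "\<And>a. a \<in> B \<Longrightarrow> v \<le> a x"
    unfolding v_def using insert.prems by (auto intro: LeastI Least_le)
  have "{a \<in> A. a x = u} \<noteq> {}" "{b \<in> B. b x = v} \<noteq> {}"
    using u v by auto
  from insert.IH[OF this] obtain a b where ab: "a \<in> A" "a x = u" "b \<in> B" "b x = v"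
    and *: "\<And>a' b'. \<lbrakk>a' \<in> A; a' x = u; b' \<in> B; b' x = v; a' + b' = a + b\<rbrakk>
              \<Longrightarrow> \<forall>i\<in>S. a' i = a i \<and> b' i = b i"
    by blast
  have key: "\<forall>i\<in>insert x S. a' i = a i \<and> b' i = b i"
    if "a' \<in> A" "b' \<in> B" "a' + b' = a + b" for a' b'
  proof -
    have "a' x + b' x = u + v"
      using fun_cong[OF that(3), of x] ab by simp
    then have "a' x = u" "b' x = v"
      using u(2)[OF that(1)] v(2)[OF that(2)] by linarith+
    then show ?thesis
      using *[of a' b'] that ab by auto
  qed
  show ?case
    by (rule bexI[OF _ ab(1)], rule bexI[OF _ ab(3)], rule ballI, rule ballI, rule impI, rule key)
qed

instance mfps :: (idom, finite) idom
proof
  fix f g :: "('a, 'b) mfps"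
  assume nz: "f \<noteq> 0" "g \<noteq> 0"
  have nonempty: "{e. mfps_coeff h e \<noteq> 0} \<noteq> {}" if "h \<noteq> 0" for h :: "('a, 'b) mfps"
  proof
    assume "{e. mfps_coeff h e \<noteq> 0} = {}"
    then have "h = 0"
      by (intro mfps_eqI) (simp add: zero_mfps.rep_eq)
    with that show False ..
  qed
  from unique_leading_split[OF finite_class.finite_UNIV nonempty[OF nz(1)] nonempty[OF nz(2)]]
  obtain a b where ab: "mfps_coeff f a \<noteq> 0" "mfps_coeff g b \<noteq> 0"
    and **: "\<forall>a'\<in>{e. mfps_coeff f e \<noteq> 0}. \<forall>b'\<in>{e. mfps_coeff g e \<noteq> 0}.
               a' + b' = a + b \<longrightarrow> (\<forall>i\<in>UNIV. a' i = a i \<and> b' i = b i)"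
    by (elim bexE) simp
  have *: "a' = a \<and> b' = b"
    if "mfps_coeff f a' \<noteq> 0" "mfps_coeff g b' \<noteq> 0" "a' + b' = a + b" for a' b'
  proof -
    have "a' i = a i \<and> b' i = b i" for i
      by (rule **[rule_format]) (use that in simp_all)
    then show ?thesis
      by (simp add: fun_eq_iff)
  qed
  have "mfps_coeff (f * g) (a + b) = (\<Sum>(a', b')\<in>{(a, b)}. mfps_coeff f a' * mfps_coeff g b')"
    unfolding times_mfps.rep_eq
  proof (intro sum.mono_neutral_right finite_splits ballI)
    show "{(a, b)} \<subseteq> splits (a + b)"
      by (simp add: splits_def)
    fix p assume p: "p \<in> splits (a + b) - {(a, b)}"
    obtain a' b' where "p = (a', b')"
      by (cases p)
    with p show "(case p of (a', b') \<Rightarrow> mfps_coeff f a' * mfps_coeff g b') = 0"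
      using *[of a' b'] by (cases "mfps_coeff f a' = 0"; cases "mfps_coeff g b' = 0") (simp_all add: splits_def)
  qed
  then have "mfps_coeff (f * g) (a + b) \<noteq> 0"
    using ab by simp
  then show "f * g \<noteq> 0"
    by (metis zero_mfps.rep_eq)
qed

definition mfps_monom :: "('r \<Rightarrow> nat) \<Rightarrow> ('k::zero_neq_one, 'r) mfps" where
  "mfps_monom d = Abs_mfps (\<lambda>e. if e = d then 1 else 0)"

definition mfps_var :: "'r \<Rightarrow> ('k::zero_neq_one, 'r) mfps" where
  "mfps_var i = mfps_monom (\<lambda>j. if j = i then 1 else 0)"


section \<open>Subfields, adjunction and separability\<close>

definition field_embedding :: "('a::field \<Rightarrow> 'b::field) \<Rightarrow> bool" where
  "field_embedding \<iota> \<longleftrightarrow>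
     \<iota> 1 = 1 \<and> (\<forall>x y. \<iota> (x + y) = \<iota> x + \<iota> y) \<and> (\<forall>x y. \<iota> (x * y) = \<iota> x * \<iota> y)"

definition algebraic_elem :: "('a::field \<Rightarrow> 'b::field) \<Rightarrow> 'b \<Rightarrow> bool" where
  "algebraic_elem \<iota> \<alpha> \<longleftrightarrow> (\<exists>p. p \<noteq> 0 \<and> poly (map_poly \<iota> p) \<alpha> = 0)"

definition algebraic_closure_embedding :: "('a::field \<Rightarrow> 'b::alg_closed_field) \<Rightarrow> bool" where
  "algebraic_closure_embedding \<iota> \<longleftrightarrow> field_embedding \<iota> \<and> (\<forall>\<alpha>. algebraic_elem \<iota> \<alpha>)"

text \<open>
  Over an algebraically closed field \<open>'b\<close>, \<open>rsquarefree\<close> says that the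
  polynomial has no multiple root in \<open>'b\<close>.
\<close>

definition separable_elem :: "('a::field \<Rightarrow> 'b::alg_closed_field) \<Rightarrow> 'b \<Rightarrow> bool" where
  "separable_elem \<iota> \<alpha> \<longleftrightarrow>
     (\<exists>p. irreducible p \<and> poly (map_poly \<iota> p) \<alpha> = 0 \<and> rsquarefree (map_poly \<iota> p))"

definition is_subfield :: "'b::field set \<Rightarrow> bool" where
  "is_subfield F \<longleftrightarrow> 0 \<in> F \<and> 1 \<in> F \<and>
     (\<forall>x\<in>F. \<forall>y\<in>F. x + y \<in> F \<and> x * y \<in> F) \<and> (\<forall>x\<in>F. - x \<in> F \<and> inverse x \<in> F)"

definition algebraic_separable_extension ::
  "('a::field \<Rightarrow> 'b::alg_closed_field) \<Rightarrow> 'b set \<Rightarrow> bool" where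
  "algebraic_separable_extension \<iota> F \<longleftrightarrow> is_subfield F \<and> range \<iota> \<subseteq> F \<and>
     (\<forall>\<alpha>\<in>F. algebraic_elem \<iota> \<alpha> \<and> separable_elem \<iota> \<alpha>)"

definition field_adjoin :: "('a::field \<Rightarrow> 'b::field) \<Rightarrow> 'b set \<Rightarrow> 'b set" where
  "field_adjoin \<iota> P = \<Inter>{F. is_subfield F \<and> range \<iota> \<subseteq> F \<and> P \<subseteq> F}"

definition ring_adjoin :: "('a::field \<Rightarrow> 'b::field) \<Rightarrow> 'b \<Rightarrow> 'b set" where
  "ring_adjoin \<iota> \<zeta> = {poly (map_poly \<iota> p) \<zeta> | p. True}"


section \<open>Puiseux power series\<close>

text \<open>
  \<open>\<rho> i m\<close> is the chosen root \<open>X\<^sub>i\<^bsup>1/m\<^esup>\<close> in the algebraic closure.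
\<close>

definition compatible_roots ::
  "(('k::idom, 'r::finite) mfps fract \<Rightarrow> 'c::field) \<Rightarrow> ('r \<Rightarrow> nat \<Rightarrow> 'c) \<Rightarrow> bool" where
  "compatible_roots \<iota> \<rho> \<longleftrightarrow>
     (\<forall>i. \<rho> i 1 = \<iota> (to_fract (mfps_var i))) \<and>
     (\<forall>i m q. m > 0 \<longrightarrow> q > 0 \<longrightarrow> \<rho> i (m * q) ^ q = \<rho> i m)"

definition root_monom :: "('r::finite \<Rightarrow> nat \<Rightarrow> 'c::field) \<Rightarrow> nat \<Rightarrow> ('r \<Rightarrow> nat) \<Rightarrow> 'c" where
  "root_monom \<rho> m e = (\<Prod>i\<in>UNIV. \<rho> i m ^ e i)"

text \<open>
  Sorting exponents by their residues modulo \<open>m\<close>, a power series \<open>f\<close> in variables \<open>Y\<^sub>i\<close> is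
  the finite sum over \<open>d\<close> with all \<open>d\<^sub>i < m\<close> of \<open>f\<^sub>d(Y\<^sub>1\<^sup>m, \<dots>, Y\<^sub>r\<^sup>m) Y\<^sup>d\<close>.
  Replacing \<open>Y\<^sub>i\<close> by \<open>X\<^sub>i\<^bsup>1/m\<^esup>\<close> turns this into the sum of \<open>f\<^sub>d X\<^bsup>d/m\<^esup>\<close> with
  \<open>f\<^sub>d\<close> in \<open>k[[X\<^sub>1, \<dots>, X\<^sub>r]]\<close>, which is how \<open>f(X\<^sub>1\<^bsup>1/m\<^esup>, \<dots>, X\<^sub>r\<^bsup>1/m\<^esup>)\<close>
  is viewed inside the algebraic closure.
\<close>

definition residue_part :: "nat \<Rightarrow> ('r \<Rightarrow> nat) \<Rightarrow> ('k, 'r) mfps \<Rightarrow> ('k, 'r) mfps" where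
  "residue_part m d f = Abs_mfps (\<lambda>e. mfps_coeff f (\<lambda>i. m * e i + d i))"

definition puiseux ::
  "(('k::idom, 'r::finite) mfps fract \<Rightarrow> 'c::field) \<Rightarrow> ('r \<Rightarrow> nat \<Rightarrow> 'c) \<Rightarrow> nat \<Rightarrow> ('k, 'r) mfps \<Rightarrow> 'c"
where
  "puiseux \<iota> \<rho> m f =
     (\<Sum>d\<in>{d. \<forall>i. d i < m}. \<iota> (to_fract (residue_part m d f)) * root_monom \<rho> m d)"

definition puiseux_ring ::
  "(('k::idom, 'r::finite) mfps fract \<Rightarrow> 'c::field) \<Rightarrow> ('r \<Rightarrow> nat \<Rightarrow> 'c) \<Rightarrow> nat \<Rightarrow> 'c set" where
  "puiseux_ring \<iota> \<rho> m = range (puiseux \<iota> \<rho> m)"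

text \<open>
  \<open>subst_power m f\<close> is \<open>f(Y\<^sub>1\<^sup>m, \<dots>, Y\<^sub>r\<^sup>m)\<close>. The lemmas below show that \<open>puiseux \<iota> \<rho> m\<close> is
  the map intended by that identification: a ring homomorphism
  that agrees with \<open>\<iota>\<close> under the identification \<open>X\<^sub>i = Y\<^sub>i\<^sup>m\<close> and maps \<open>Y\<^sub>i\<close> to \<open>X\<^sub>i\<^bsup>1/m\<^esup>\<close>.
\<close>

definition subst_power :: "nat \<Rightarrow> ('k::zero, 'r) mfps \<Rightarrow> ('k, 'r) mfps" where
  "subst_power m f =
     Abs_mfps (\<lambda>e. if \<forall>i. m dvd e i then mfps_coeff f (\<lambda>i. e i div m) else 0)"

lemma residue_part_subst_power_mult:
  fixes f g :: "('k::idom, 'r::finite) mfps"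
  assumes d: "\<And>i. d i < m"
  shows "residue_part m d (subst_power m f * g) = f * residue_part m d g"
proof (rule mfps_eqI)
  fix e :: "'r \<Rightarrow> nat"
  have m: "m > 0"
    using d[of undefined] by simp
  define h where "h = (\<lambda>(a :: 'r \<Rightarrow> nat, b :: 'r \<Rightarrow> nat). (\<lambda>i. m * a i, \<lambda>i. m * b i + d i))"
  define u where "u = (\<lambda>i. m * e i + d i)"
  define t where "t = (\<lambda>(a, b). mfps_coeff (subst_power m f) a * mfps_coeff g b)"
  have inj: "inj_on h (splits e)"
    using m by (auto simp: h_def inj_on_def fun_eq_iff)
  have sub: "h ` splits e \<subseteq> splits u"
    by (auto simp: h_def splits_def u_def fun_eq_iff distrib_left[symmetric] add.assoc[symmetric])
  have van: "t p = 0" if "p \<in> splits u - h ` splits e" for p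
  proof (rule ccontr)
    assume nz: "t p \<noteq> 0"
    obtain a b where p: "p = (a, b)" by (cases p)
    from that p have "a + b = u"
      by (simp add: splits_def)
    then have ab: "a i + b i = m * e i + d i" for i
      unfolding u_def by (metis plus_fun_apply)
    from nz p have dv: "m dvd a i" for i
      by (auto simp: t_def subst_power_def split: if_splits)
    define a' where "a' = (\<lambda>i. a i div m)"
    have a: "a i = m * a' i" for i
      using dv[of i] by (simp add: a'_def)
    have le: "a' i \<le> e i" for i
    proof -
      have "m * a' i < m * (e i + 1)"
        using ab[of i] d[of i] a[of i] by (simp add: algebra_simps)
      then have "a' i < e i + 1"
        using m by (simp only: mult_less_cancel1)
      then show ?thesis by simp
    qed
    have b: "b i = m * (e i - a' i) + d i" for i
      using ab[of i] a[of i] le[of i] by (simp add: diff_mult_distrib2)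
    have "p = h (a', \<lambda>i. e i - a' i)"
      unfolding p h_def by (simp add: fun_eq_iff a b)
    moreover have "(a', \<lambda>i. e i - a' i) \<in> splits e"
      using le by (simp add: splits_def fun_eq_iff)
    ultimately show False
      using that by blast
  qed
  have "mfps_coeff (residue_part m d (subst_power m f * g)) e = sum t (splits u)"
    by (simp add: residue_part_def times_mfps.rep_eq t_def u_def)
  also have "\<dots> = sum t (h ` splits e)"
    by (rule sum.mono_neutral_right) (use sub van in auto)
  also have "\<dots> = (\<Sum>p\<in>splits e. t (h p))"
    by (simp add: sum.reindex[OF inj])
  also have "\<dots> = mfps_coeff (f * residue_part m d g) e"
    unfolding times_mfps.rep_eq
    by (rule sum.cong) (use m in \<open>auto simp: t_def h_def subst_power_def residue_part_def\<close>)
  finally show "mfps_coeff (residue_part m d (subst_power m f * g)) e =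
    mfps_coeff (f * residue_part m d g) e" .
qed

lemma mfps_coeff_sum: "mfps_coeff (sum f A) e = (\<Sum>x\<in>A. mfps_coeff (f x) e)"
  by (induction A rule: infinite_finite_induct) (simp_all add: zero_mfps.rep_eq plus_mfps.rep_eq)

lemma mfps_coeff_mult_monom:
  fixes f :: "('k::idom, 'r::finite) mfps"
  shows "mfps_coeff (f * mfps_monom d) e =
    (if \<forall>i. d i \<le> e i then mfps_coeff f (\<lambda>i. e i - d i) else 0)"
proof (cases "\<forall>i. d i \<le> e i")
  case True
  have "mfps_coeff (f * mfps_monom d) e =
      (\<Sum>(a, b)\<in>{(\<lambda>i. e i - d i, d)}. mfps_coeff f a * mfps_coeff (mfps_monom d) b)"
    unfolding times_mfps.rep_eq
  proof (intro sum.mono_neutral_right finite_splits ballI)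
    show "{(\<lambda>i. e i - d i, d)} \<subseteq> splits e"
      using True by (simp add: splits_def fun_eq_iff)
    fix p assume p: "p \<in> splits e - {(\<lambda>i. e i - d i, d)}"
    obtain a b where ab: "p = (a, b)" by (cases p)
    have "b \<noteq> d"
    proof
      assume "b = d"
      with p ab have "a = (\<lambda>i. e i - d i)"
        by (auto simp: splits_def)
      with p ab \<open>b = d\<close> show False by simp
    qed
    then show "(case p of (a, b) \<Rightarrow> mfps_coeff f a * mfps_coeff (mfps_monom d) b) = 0"
      by (simp add: ab mfps_monom_def)
  qed
  with True show ?thesis
    by (simp add: mfps_monom_def)
next
  case False
  have "mfps_coeff (f * mfps_monom d) e = 0"
    unfolding times_mfps.rep_eq
  proof (intro sum.neutral ballI)
    fix p assume p: "p \<in> splits e"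
    obtain a b where ab: "p = (a, b)" by (cases p)
    have "b \<noteq> d"
      using False p ab by (auto simp: splits_def)
    then show "(case p of (a, b) \<Rightarrow> mfps_coeff f a * mfps_coeff (mfps_monom d) b) = 0"
      by (simp add: ab mfps_monom_def)
  qed
  then show ?thesis
    by (simp only: False if_False)
qed

lemma mfps_monom_0: "mfps_monom 0 = (1 :: ('k::idom, 'r::finite) mfps)"
  by (rule mfps_eqI) (simp add: mfps_monom_def one_mfps.rep_eq)

lemma mfps_monom_add:
  "mfps_monom (a + b) = (mfps_monom a * mfps_monom b :: ('k::idom, 'r::finite) mfps)"
proof (rule mfps_eqI)
  fix e :: "'r \<Rightarrow> nat"
  have "e = a + b \<longleftrightarrow> (\<forall>i. b i \<le> e i) \<and> (\<lambda>i. e i - b i) = a"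
  proof
    assume "(\<forall>i. b i \<le> e i) \<and> (\<lambda>i. e i - b i) = a"
    then have "b i \<le> e i" "e i - b i = a i" for i
      by auto
    then have "e i = a i + b i" for i
      by (metis le_add_diff_inverse2)
    then show "e = a + b"
      by (simp add: fun_eq_iff)
  qed simp
  then show "mfps_coeff (mfps_monom (a + b)) e =
      mfps_coeff (mfps_monom a * mfps_monom b :: ('k, 'r) mfps) e"
    unfolding mfps_coeff_mult_monom by (auto simp only: mfps_monom_def mfps_coeff_Abs split: if_splits)
qed

lemma mfps_monom_eq_prod:
  "(mfps_monom d :: ('k::idom, 'r::finite) mfps) = (\<Prod>i\<in>UNIV. mfps_var i ^ d i)"
proof -
  have pow: "(mfps_var i ^ n :: ('k, 'r) mfps) = mfps_monom (\<lambda>j. if j = i then n else 0)" for i n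
  proof (induction n)
    case 0
    have "(\<lambda>j. if j = i then 0 else 0) = (0 :: 'r \<Rightarrow> nat)"
      by (simp add: fun_eq_iff)
    then show ?case
      by (simp add: mfps_monom_0)
  next
    case (Suc n)
    have "(\<lambda>j. if j = i then Suc n else 0) = (\<lambda>j. if j = i then 1 else 0) + (\<lambda>j. if j = i then n else 0)"
      by (simp add: fun_eq_iff)
    then show ?case
      by (metis Suc.IH mfps_monom_add mfps_var_def power_Suc)
  qed
  have "(\<Prod>i\<in>S. mfps_var i ^ d i) = (mfps_monom (\<lambda>j. if j \<in> S then d j else 0) :: ('k, 'r) mfps)"
    if "finite S" for S
    using that
  proof (induction S rule: finite_induct)
    case empty
    have "(\<lambda>j. if j \<in> {} then d j else 0) = 0"
      by (simp add: fun_eq_iff)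
    then show ?case
      by (simp only: prod.empty mfps_monom_0)
  next
    case (insert x S)
    have "(\<lambda>j. if j \<in> insert x S then d j else 0) =
        (\<lambda>j. if j = x then d x else 0) + (\<lambda>j. if j \<in> S then d j else 0)"
      using insert.hyps by (auto simp: fun_eq_iff)
    then show ?case
      using insert by (simp only: prod.insert pow mfps_monom_add simp_thms)
  qed
  from this[OF finite_class.finite_UNIV] show ?thesis
    by simp
qed

lemma finite_residues [simp]: "finite {d :: 'r::finite \<Rightarrow> nat. \<forall>i. d i < m}"
  by (rule finite_subset[OF _ finite_exponent_box[of "\<lambda>_. m"]]) (auto intro: less_imp_le)

lemma mfps_residue_decomposition:
  fixes f :: "('k::idom, 'r::finite) mfps"
  assumes m: "m > 0"
  shows "f = (\<Sum>d\<in>{d. \<forall>i. d i < m}. subst_power m (residue_part m d f) * mfps_monom d)"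
proof (rule mfps_eqI)
  fix e :: "'r \<Rightarrow> nat"
  define d0 where "d0 = (\<lambda>i. e i mod m)"
  have "(\<Sum>d\<in>{d. \<forall>i. d i < m}. mfps_coeff (subst_power m (residue_part m d f) * mfps_monom d) e) =
        (\<Sum>d\<in>{d0}. mfps_coeff (subst_power m (residue_part m d f) * mfps_monom d) e)"
  proof (rule sum.mono_neutral_right)
    show "{d0} \<subseteq> {d. \<forall>i. d i < m}"
      using m by (simp add: d0_def)
    show "\<forall>d\<in>{d. \<forall>i. d i < m} - {d0}.
        mfps_coeff (subst_power m (residue_part m d f) * mfps_monom d) e = 0"
    proof
      fix d assume d: "d \<in> {d. \<forall>i. d i < m} - {d0}"
      then obtain i where i: "d i \<noteq> e i mod m"
        by (auto simp: d0_def fun_eq_iff)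
      from d have di: "d i < m"
        by simp
      have "\<not> m dvd e i - d i" if "d i \<le> e i"
        using that i di by (metis mod_eq_dvd_iff_nat mod_less)
      then show "mfps_coeff (subst_power m (residue_part m d f) * mfps_monom d) e = 0"
        unfolding mfps_coeff_mult_monom by (auto simp: subst_power_def)
    qed
  qed simp
  also have "\<dots> = mfps_coeff f e"
    unfolding mfps_coeff_mult_monom
    by (simp add: subst_power_def residue_part_def d0_def minus_mod_eq_mult_div m)
  finally show "mfps_coeff f e =
    mfps_coeff (\<Sum>d\<in>{d. \<forall>i. d i < m}. subst_power m (residue_part m d f) * mfps_monom d) e"
    by (simp add: mfps_coeff_sum)
qed

lemma field_embedding_0: "field_embedding \<iota> \<Longrightarrow> \<iota> 0 = 0"
  unfolding field_embedding_def by (metis add_cancel_right_right)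

lemma root_monom_add: "root_monom \<rho> m (a + b) = root_monom \<rho> m a * root_monom \<rho> m b"
  by (simp add: root_monom_def power_add prod.distrib)

lemma to_fract_mult': "to_fract (x * y) = to_fract x * to_fract y"
  by (simp add: to_fract_def)

context
  fixes \<iota> :: "('k::idom, 'r::finite) mfps fract \<Rightarrow> 'c::field" and \<rho> :: "'r \<Rightarrow> nat \<Rightarrow> 'c" and m :: nat
  assumes \<iota>: "field_embedding \<iota>" and \<rho>: "compatible_roots \<iota> \<rho>" and m: "m > 0"
begin

lemma puiseux_add: "puiseux \<iota> \<rho> m (f + g) = puiseux \<iota> \<rho> m f + puiseux \<iota> \<rho> m g"
proof -
  have "residue_part m d (f + g) = residue_part m d f + residue_part m d g" for d
    by (rule mfps_eqI) (simp add: residue_part_def plus_mfps.rep_eq)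
  moreover have "\<iota> (x + y) = \<iota> x + \<iota> y" for x y
    using \<iota> by (simp add: field_embedding_def)
  ultimately show ?thesis
    by (simp add: puiseux_def sum.distrib distrib_right to_fract_add)
qed

lemma puiseux_0: "puiseux \<iota> \<rho> m 0 = 0"
proof -
  have "residue_part m d (0 :: ('k, 'r) mfps) = 0" for d
    by (rule mfps_eqI) (simp add: residue_part_def zero_mfps.rep_eq)
  then show ?thesis
    by (simp add: puiseux_def field_embedding_0[OF \<iota>])
qed

lemma puiseux_sum: "puiseux \<iota> \<rho> m (sum f A) = (\<Sum>x\<in>A. puiseux \<iota> \<rho> m (f x))"
  by (induction A rule: infinite_finite_induct) (simp_all add: puiseux_add puiseux_0)

lemma puiseux_subst_power_mult:
  "puiseux \<iota> \<rho> m (subst_power m f * g) = \<iota> (to_fract f) * puiseux \<iota> \<rho> m g"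
proof -
  have mult: "\<iota> (x * y) = \<iota> x * \<iota> y" for x y
    using \<iota> by (simp add: field_embedding_def)
  show ?thesis
    unfolding puiseux_def sum_distrib_left
    by (rule sum.cong) (simp_all add: residue_part_subst_power_mult to_fract_mult' mult mult.assoc)
qed

lemma puiseux_monom: "puiseux \<iota> \<rho> m (mfps_monom c) = root_monom \<rho> m c"
proof -
  have mult: "\<iota> (x * y) = \<iota> x * \<iota> y" for x y
    using \<iota> by (simp add: field_embedding_def)
  have one: "\<iota> 1 = 1"
    using \<iota> by (simp add: field_embedding_def)
  have pow: "\<iota> (x ^ n) = \<iota> x ^ n" for x n
    by (induction n) (simp_all add: one mult)
  have prod: "\<iota> (to_fract (prod h A)) = (\<Prod>x\<in>A. \<iota> (to_fract (h x)))" for h and A :: "'r set"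
    by (induction A rule: infinite_finite_induct) (simp_all add: one mult to_fract_mult')
  have fpow: "to_fract (x ^ n) = to_fract x ^ n" for x :: "('k, 'r) mfps" and n
    by (induction n) (simp_all add: to_fract_mult')
  have var: "\<iota> (to_fract (mfps_var i)) = \<rho> i m ^ m" for i
  proof -
    have "\<rho> i (1 * m) ^ m = \<rho> i 1"
      using \<rho> m unfolding compatible_roots_def by (metis less_numeral_extra(1))
    then show ?thesis
      using \<rho> by (simp add: compatible_roots_def)
  qed
  define q where "q = (\<lambda>i. c i div m)"
  define d0 where "d0 = (\<lambda>i. c i mod m)"
  have c: "m * q i + d0 i = c i" for i
    by (simp add: q_def d0_def)
  have res: "residue_part m d (mfps_monom c :: ('k, 'r) mfps) = (if d = d0 then mfps_monom q else 0)"
    if d: "\<And>i. d i < m" for d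
  proof (rule mfps_eqI)
    fix e :: "'r \<Rightarrow> nat"
    have "(\<lambda>i. m * e i + d i) = c \<longleftrightarrow> d = d0 \<and> e = q"
    proof
      assume "(\<lambda>i. m * e i + d i) = c"
      then have "c i = m * e i + d i" for i
        by auto
      then show "d = d0 \<and> e = q"
        using d m by (simp add: d0_def q_def fun_eq_iff)
    next
      assume "d = d0 \<and> e = q"
      then show "(\<lambda>i. m * e i + d i) = c"
        by (simp add: fun_eq_iff c)
    qed
    then show "mfps_coeff (residue_part m d (mfps_monom c :: ('k, 'r) mfps)) e =
        mfps_coeff (if d = d0 then mfps_monom q else 0) e"
      by (simp add: residue_part_def mfps_monom_def zero_mfps.rep_eq)
  qed
  have "puiseux \<iota> \<rho> m (mfps_monom c) =
      (\<Sum>d\<in>{d. \<forall>i. d i < m}. if d = d0 then \<iota> (to_fract (mfps_monom q)) * root_monom \<rho> m d else 0)"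
    unfolding puiseux_def
    by (rule sum.cong) (simp_all add: res field_embedding_0[OF \<iota>])
  also have "\<dots> = \<iota> (to_fract (mfps_monom q)) * root_monom \<rho> m d0"
    using m by (simp add: sum.delta d0_def)
  also have "\<iota> (to_fract (mfps_monom q)) = (\<Prod>i\<in>UNIV. \<rho> i m ^ (m * q i))"
    by (simp add: mfps_monom_eq_prod prod fpow pow var power_mult)
  also have "(\<Prod>i\<in>UNIV. \<rho> i m ^ (m * q i)) * root_monom \<rho> m d0 = root_monom \<rho> m c"
    unfolding root_monom_def prod.distrib[symmetric] power_add[symmetric] c ..
  finally show ?thesis .
qed

lemma puiseux_mult: "puiseux \<iota> \<rho> m (f * g) = puiseux \<iota> \<rho> m f * puiseux \<iota> \<rho> m g"
proof -
  define D where "D = {d :: 'r \<Rightarrow> nat. \<forall>i. d i < m}"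
  have shift: "puiseux \<iota> \<rho> m (mfps_monom d * g) = root_monom \<rho> m d * puiseux \<iota> \<rho> m g" for d
  proof -
    have "mfps_monom d * g =
        (\<Sum>d'\<in>D. subst_power m (residue_part m d' g) * mfps_monom (d + d'))"
      unfolding D_def
      by (subst mfps_residue_decomposition[OF m, of g])
         (simp add: sum_distrib_left mfps_monom_add mult_ac)
    then have "puiseux \<iota> \<rho> m (mfps_monom d * g) =
        (\<Sum>d'\<in>D. \<iota> (to_fract (residue_part m d' g)) * root_monom \<rho> m (d + d'))"
      by (simp only: puiseux_sum puiseux_subst_power_mult puiseux_monom)
    also have "\<dots> = root_monom \<rho> m d * puiseux \<iota> \<rho> m g"
      by (simp add: puiseux_def D_def root_monom_add sum_distrib_left mult_ac)
    finally show ?thesis .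
  qed
  have "f * g = (\<Sum>d\<in>D. subst_power m (residue_part m d f) * (mfps_monom d * g))"
    unfolding D_def
    by (subst mfps_residue_decomposition[OF m, of f])
       (simp add: sum_distrib_right mult.assoc)
  then have "puiseux \<iota> \<rho> m (f * g) =
      (\<Sum>d\<in>D. \<iota> (to_fract (residue_part m d f)) * (root_monom \<rho> m d * puiseux \<iota> \<rho> m g))"
    by (simp only: puiseux_sum puiseux_subst_power_mult shift)
  also have "\<dots> = puiseux \<iota> \<rho> m f * puiseux \<iota> \<rho> m g"
    by (simp add: puiseux_def D_def sum_distrib_right mult.assoc)
  finally show ?thesis .
qed

lemma puiseux_1: "puiseux \<iota> \<rho> m 1 = 1"
  using puiseux_monom[of 0] by (simp add: mfps_monom_0 root_monom_def)

lemma puiseux_subst_power: "puiseux \<iota> \<rho> m (subst_power m f) = \<iota> (to_fract f)"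
  using puiseux_subst_power_mult[of f 1] by (simp add: puiseux_1)

lemma puiseux_var: "puiseux \<iota> \<rho> m (mfps_var i) = \<rho> i m"
proof -
  have "root_monom \<rho> m (\<lambda>j. if j = i then 1 else 0) = (\<Prod>j\<in>UNIV. if j = i then \<rho> j m else 1)"
    unfolding root_monom_def by (rule prod.cong) auto
  then show ?thesis
    by (simp add: mfps_var_def puiseux_monom)
qed

end

end

theory Submission
  imports Defs
begin

text \<open>
  For \<open>m\<close> prime to the characteristic, the group \<open>\<mu>\<^sub>m\<^sup>r\<close> of tuples of \<open>m\<close>-th roots of unity acts on
  power series in \<open>Y\<^sub>1, \<dots>, Y\<^sub>r\<close> by scaling the variables, and its invariants are exactly the
  series in \<open>Y\<^sub>1\<^sup>m, \<dots>, Y\<^sub>r\<^sup>m\<close> (\<open>twist_invariant_imp_subst_power\<close>). Both directions of the theorem rest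
  on one fact (\<open>root_monom_in_subfield\<close>): if some monomial whose exponent is congruent to \<open>d\<close>
  modulo \<open>m\<close> occurs in the series \<open>f\<close> and \<open>\<zeta> = f(X\<^sub>1\<^bsup>1/m\<^esup>, \<dots>, X\<^sub>r\<^bsup>1/m\<^esup>)\<close>, then \<open>X\<^bsup>d/m\<^esup>\<close> lies in \<open>K(\<zeta>)\<close>.

  In Galois terms, an element of \<open>\<mu>\<^sub>m\<^sup>r\<close> that fixes \<open>f\<close> fixes every monomial of \<open>f\<close>. This is made
  explicit by Lagrange interpolation over the finite orbit \<open>V\<close> of \<open>f\<close>: the polynomial
  \<open>F(T) = \<Sum>\<^sub>v h(v) \<Prod>\<^sub>w\<^sub>\<noteq>\<^sub>v (T - w)\<close>, where \<open>h\<close> is the equivariant map from \<open>V\<close> to the orbit of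
  \<open>Y\<^sup>d\<close> with \<open>h(f) = Y\<^sup>d\<close>, and its analogue \<open>G(T)\<close> with \<open>h = 1\<close> have invariant coefficients, and
  \<open>F(f) = Y\<^sup>d G(f)\<close> with \<open>G(f) \<noteq> 0\<close>. Substituting \<open>Y\<^sub>i = X\<^sub>i\<^bsup>1/m\<^esup>\<close>, which is injective since a nonzero
  element of the kernel would have a nonzero invariant norm in the kernel
  (\<open>puiseux_eq_0_iff\<close>), writes \<open>X\<^bsup>d/m\<^esup>\<close> as a quotient of two polynomials in \<open>\<zeta>\<close> over \<open>K\<close>.

  Hence \<open>K(\<zeta>)\<close>, which is \<open>K[\<zeta>]\<close> because \<open>\<zeta>\<close> is algebraic, is generated by the monomials that occur in \<open>\<zeta>\<close>. Conversely a field generated by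
  monomials in \<open>S\<^sub>m\<close> is generated by the sum of all \<open>X\<^bsup>d/m\<^esup>\<close>, \<open>0 \<le> d\<^sub>i < m\<close>, that it contains.
\<close>

section \<open>Ring homomorphisms and polynomials\<close>

lemma map_poly_plus_hom:
  assumes "\<phi> 0 = 0" and "\<And>x y. \<phi> (x + y) = \<phi> x + \<phi> y"
  shows "map_poly \<phi> (p + q) = map_poly \<phi> p + map_poly \<phi> q"
  by (rule poly_eqI) (simp add: coeff_map_poly assms)

lemma hom_sum:
  assumes "\<phi> 0 = 0" and "\<And>x y. \<phi> (x + y) = \<phi> x + \<phi> y"
  shows "\<phi> (sum h A) = (\<Sum>x\<in>A. \<phi> (h x))"
  by (induction A rule: infinite_finite_induct) (simp_all add: assms)

lemma map_poly_mult_hom: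
  fixes \<phi> :: "'a::comm_semiring_0 \<Rightarrow> 'b::comm_semiring_0"
  assumes "\<phi> 0 = 0" and "\<And>x y. \<phi> (x + y) = \<phi> x + \<phi> y" and "\<And>x y. \<phi> (x * y) = \<phi> x * \<phi> y"
  shows "map_poly \<phi> (p * q) = map_poly \<phi> p * map_poly \<phi> q"
  by (rule poly_eqI) (simp add: coeff_map_poly coeff_mult hom_sum[of \<phi>] assms)

lemma map_poly_prod_hom:
  fixes \<phi> :: "'a::comm_semiring_1 \<Rightarrow> 'b::comm_semiring_1"
  assumes "\<phi> 0 = 0" "\<phi> 1 = 1" "\<And>x y. \<phi> (x + y) = \<phi> x + \<phi> y" "\<And>x y. \<phi> (x * y) = \<phi> x * \<phi> y"
  shows "map_poly \<phi> (prod h A) = (\<Prod>x\<in>A. map_poly \<phi> (h x))"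
  by (induction A rule: infinite_finite_induct)
     (simp_all add: assms map_poly_mult_hom[of \<phi>])

text \<open>
  The numerator of Lagrange interpolation: up to the factor \<open>\<Prod>\<^sub>w\<^sub>\<noteq>\<^sub>v (v - w)\<close>, this polynomial takes
  the value \<open>h v\<close> at each node \<open>v \<in> V\<close>. Not dividing keeps the coefficients in the ring.
\<close>

definition lagrange_numerator :: "'a::comm_ring_1 set \<Rightarrow> ('a \<Rightarrow> 'a) \<Rightarrow> 'a poly" where
  "lagrange_numerator V h = (\<Sum>v\<in>V. smult (h v) (\<Prod>w\<in>V - {v}. [:- w, 1:]))"

lemma poly_lagrange_numerator:
  assumes "finite V" "u \<in> V"
  shows "poly (lagrange_numerator V h) u = h u * (\<Prod>w\<in>V - {u}. u - w)"
proof -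
  have "poly (lagrange_numerator V h) u = (\<Sum>v\<in>V. h v * (\<Prod>w\<in>V - {v}. u - w))"
    by (simp add: lagrange_numerator_def poly_sum poly_prod)
  also have "\<dots> = (\<Sum>v\<in>{u}. h v * (\<Prod>w\<in>V - {v}. u - w))"
  proof (rule sum.mono_neutral_right)
    show "\<forall>v\<in>V - {u}. h v * (\<Prod>w\<in>V - {v}. u - w) = 0"
    proof
      fix v assume "v \<in> V - {u}"
      then have "u \<in> V - {v}"
        using assms by auto
      then have "(\<Prod>w\<in>V - {v}. u - w) = 0"
        using assms by (subst prod.remove[of _ u]) auto
      then show "h v * (\<Prod>w\<in>V - {v}. u - w) = 0"
        by simp
    qed
  qed (use assms in auto)
  finally show ?thesis
    by simp
qed

lemma map_poly_lagrange_numerator: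
  fixes \<phi> :: "'a::comm_ring_1 \<Rightarrow> 'a"
  assumes \<phi>: "\<phi> 0 = 0" "\<phi> 1 = 1" "\<And>x y. \<phi> (x + y) = \<phi> x + \<phi> y" "\<And>x y. \<phi> (x * y) = \<phi> x * \<phi> y"
    and bij: "bij_betw \<phi> V V"
    and h: "\<And>v. v \<in> V \<Longrightarrow> \<phi> (h v) = h (\<phi> v)"
  shows "map_poly \<phi> (lagrange_numerator V h) = lagrange_numerator V h"
proof -
  have minus: "\<phi> (- x) = - \<phi> x" for x
    using \<phi>(1) \<phi>(3)[of x "- x"] by (simp add: minus_unique)
  have smult: "map_poly \<phi> (smult c p) = smult (\<phi> c) (map_poly \<phi> p)" for c p
    by (simp add: map_poly_smult \<phi>)
  have inj: "inj_on \<phi> V" and img: "\<phi> ` V = V"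
    using bij by (auto simp: bij_betw_def)
  have prod: "(\<Prod>w\<in>V - {v}. [:- \<phi> w, 1:]) = (\<Prod>w\<in>V - {\<phi> v}. [:- w, 1:])" if "v \<in> V" for v
  proof -
    have "V - {\<phi> v} = \<phi> ` (V - {v})"
      using inj img that by (auto simp: inj_on_def)
    moreover have "inj_on \<phi> (V - {v})"
      using inj by (rule inj_on_subset) auto
    ultimately show ?thesis
      by (simp add: prod.reindex)
  qed
  have "map_poly \<phi> (lagrange_numerator V h) =
      (\<Sum>v\<in>V. smult (\<phi> (h v)) (\<Prod>w\<in>V - {v}. [:- \<phi> w, 1:]))"
    unfolding lagrange_numerator_def
    by (simp add: hom_sum[of "map_poly \<phi>"] map_poly_plus_hom smult
        map_poly_prod_hom[of \<phi>] \<phi> map_poly_pCons minus)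
  also have "\<dots> = (\<Sum>v\<in>V. smult (h (\<phi> v)) (\<Prod>w\<in>V - {\<phi> v}. [:- w, 1:]))"
    by (rule sum.cong) (simp_all add: h prod)
  also have "\<dots> = lagrange_numerator V h"
    unfolding lagrange_numerator_def by (rule sum.reindex_bij_betw[OF bij])
  finally show ?thesis .
qed


section \<open>Subfields and adjunction\<close>

lemma subfield_sum:
  assumes "is_subfield E" "\<And>x. x \<in> A \<Longrightarrow> h x \<in> E"
  shows "sum h A \<in> E"
  using assms(2) by (induction A rule: infinite_finite_induct) (use assms(1) in \<open>auto simp: is_subfield_def\<close>)

lemma subfield_power:
  assumes "is_subfield E" "x \<in> E"
  shows "x ^ n \<in> E"
  by (induction n) (use assms in \<open>auto simp: is_subfield_def\<close>)

lemma subfield_mult: "is_subfield E \<Longrightarrow> x \<in> E \<Longrightarrow> y \<in> E \<Longrightarrow> x * y \<in> E"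
  by (simp add: is_subfield_def)

lemma subfield_divide: "is_subfield E \<Longrightarrow> x \<in> E \<Longrightarrow> y \<in> E \<Longrightarrow> x / y \<in> E"
  by (simp add: is_subfield_def divide_inverse)

lemma ring_adjoin_subset_subfield:
  assumes "field_embedding \<iota>" "is_subfield E" "range \<iota> \<subseteq> E" "\<zeta> \<in> E"
  shows "ring_adjoin \<iota> \<zeta> \<subseteq> E"
proof
  fix x assume "x \<in> ring_adjoin \<iota> \<zeta>"
  then obtain p where x: "x = poly (map_poly \<iota> p) \<zeta>"
    by (auto simp: ring_adjoin_def)
  show "x \<in> E"
    unfolding x poly_altdef coeff_map_poly[where f = \<iota>, OF field_embedding_0[OF assms(1)]]
    using assms(3,4) by (intro subfield_sum subfield_mult subfield_power assms(2)) auto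
qed

lemma field_adjoin_superset: "range \<iota> \<subseteq> field_adjoin \<iota> P" "P \<subseteq> field_adjoin \<iota> P"
  by (auto simp: field_adjoin_def)

lemma field_adjoin_least:
  "is_subfield E \<Longrightarrow> range \<iota> \<subseteq> E \<Longrightarrow> P \<subseteq> E \<Longrightarrow> field_adjoin \<iota> P \<subseteq> E"
  by (auto simp: field_adjoin_def)

lemma is_subfield_field_adjoin: "is_subfield (field_adjoin \<iota> P)"
  by (auto simp: field_adjoin_def is_subfield_def)

text \<open>
  Dividing an equation \<open>p(y) = 0\<close> by a power of \<open>y\<close>, its constant term becomes a nonzero \<open>a\<close>,
  so that \<open>-a/y\<close> is a polynomial in \<open>y\<close>.
\<close>

lemma inverse_in_ring_of_algebraic:
  assumes \<iota>: "field_embedding \<iota>"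
    and ring: "range \<iota> \<subseteq> R" "\<And>x y. x \<in> R \<Longrightarrow> y \<in> R \<Longrightarrow> x + y \<in> R" "\<And>x y. x \<in> R \<Longrightarrow> y \<in> R \<Longrightarrow> x * y \<in> R"
    and y: "y \<in> R" "algebraic_elem \<iota> y"
  shows "inverse y \<in> R"
proof (cases "y = 0")
  case False
  note \<iota>0 = field_embedding_0[OF \<iota>]
  have inv: "\<iota> x * \<iota> (inverse x) = 1" if "x \<noteq> 0" for x
    using \<iota> that unfolding field_embedding_def by (metis right_inverse)
  have evalR: "poly (map_poly \<iota> q) y \<in> R" for q
  proof (induction q)
    case 0
    have "\<iota> 0 \<in> R" using ring by auto
    then show ?case by (simp add: \<iota>0)
  next
    case (pCons a q)
    have "\<iota> a \<in> R" using ring by auto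
    then show ?case using pCons y ring by (simp add: map_poly_pCons \<iota>0)
  qed
  have "inverse y \<in> R" if "p \<noteq> 0" "poly (map_poly \<iota> p) y = 0" for p
    using that
  proof (induction p)
    case (pCons a p)
    then have eq: "\<iota> a + y * poly (map_poly \<iota> p) y = 0"
      by (simp add: map_poly_pCons \<iota>0)
    show ?case
    proof (cases "a = 0")
      case True
      with pCons eq False show ?thesis
        by (auto simp: \<iota>0)
    next
      case nz: False
      have "\<iota> (- inverse a) + \<iota> (inverse a) = 0"
        using \<iota> \<iota>0 unfolding field_embedding_def by (metis add.left_inverse)
      then have neg: "\<iota> (- inverse a) = - \<iota> (inverse a)"
        by (simp add: eq_neg_iff_add_eq_0)
      have "y * (\<iota> (- inverse a) * poly (map_poly \<iota> p) y) = - \<iota> (inverse a) * (y * poly (map_poly \<iota> p) y)"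
        by (simp add: neg)
      also have "y * poly (map_poly \<iota> p) y = - \<iota> a"
        using eq by (simp add: eq_neg_iff_add_eq_0 add.commute)
      also have "- \<iota> (inverse a) * - \<iota> a = 1"
        using inv[OF nz] by (simp add: mult.commute)
      finally have "inverse y = \<iota> (- inverse a) * poly (map_poly \<iota> p) y"
        by (rule inverse_unique)
      moreover have "\<iota> (- inverse a) \<in> R"
        using ring by auto
      ultimately show ?thesis
        using evalR ring by auto
    qed
  qed auto
  then show ?thesis
    using y(2) by (auto simp: algebraic_elem_def)
qed (use y in simp)

lemma ring_adjoin_superset:
  assumes "field_embedding \<iota>"
  shows "range \<iota> \<subseteq> ring_adjoin \<iota> \<zeta>" "\<zeta> \<in> ring_adjoin \<iota> \<zeta>"
proof -
  note \<iota>0 = field_embedding_0[OF assms]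
  have "\<iota> x = poly (map_poly \<iota> [:x:]) \<zeta>" for x
    by (simp add: map_poly_pCons \<iota>0)
  then show "range \<iota> \<subseteq> ring_adjoin \<iota> \<zeta>"
    unfolding ring_adjoin_def by blast
  have "\<zeta> = poly (map_poly \<iota> [:0, 1:]) \<zeta>"
    using assms by (simp add: map_poly_pCons \<iota>0 field_embedding_def)
  then show "\<zeta> \<in> ring_adjoin \<iota> \<zeta>"
    unfolding ring_adjoin_def by blast
qed

lemma is_subfield_ring_adjoin:
  assumes \<iota>: "field_embedding \<iota>" and alg: "\<And>\<alpha>. algebraic_elem \<iota> \<alpha>"
  shows "is_subfield (ring_adjoin \<iota> \<zeta>)"
proof -
  let ?R = "ring_adjoin \<iota> \<zeta>"
  have hom: "\<iota> 0 = 0" "\<iota> 1 = 1" "\<And>x y. \<iota> (x + y) = \<iota> x + \<iota> y" "\<And>x y. \<iota> (x * y) = \<iota> x * \<iota> y"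
    using \<iota> field_embedding_0[OF \<iota>] by (auto simp: field_embedding_def)
  note R = ring_adjoin_superset(1)[OF \<iota>, of \<zeta>]
  have add: "x + y \<in> ?R" if xy: "x \<in> ?R" "y \<in> ?R" for x y
  proof -
    obtain p q where "x = poly (map_poly \<iota> p) \<zeta>" "y = poly (map_poly \<iota> q) \<zeta>"
      using xy by (auto simp: ring_adjoin_def)
    then have "x + y = poly (map_poly \<iota> (p + q)) \<zeta>"
      by (simp add: map_poly_plus_hom hom)
    then show ?thesis by (auto simp: ring_adjoin_def)
  qed
  have mult: "x * y \<in> ?R" if xy: "x \<in> ?R" "y \<in> ?R" for x y
  proof -
    obtain p q where "x = poly (map_poly \<iota> p) \<zeta>" "y = poly (map_poly \<iota> q) \<zeta>"
      using xy by (auto simp: ring_adjoin_def)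
    then have "x * y = poly (map_poly \<iota> (p * q)) \<zeta>"
      by (simp add: map_poly_mult_hom[of \<iota>] hom)
    then show ?thesis by (auto simp: ring_adjoin_def)
  qed
  have "\<iota> (- 1) + 1 = 0"
    using hom by (metis add.left_inverse)
  then have neg1: "\<iota> (- 1) = - 1"
    by (simp add: eq_neg_iff_add_eq_0)
  have "- x \<in> ?R" if "x \<in> ?R" for x
  proof -
    have "\<iota> (- 1) \<in> ?R"
      using R by blast
    from mult[OF this that] show ?thesis
      by (simp add: neg1)
  qed
  moreover have "inverse x \<in> ?R" if "x \<in> ?R" for x
    using inverse_in_ring_of_algebraic[OF \<iota> R add mult that alg] .
  moreover have "0 \<in> ?R" "1 \<in> ?R"
    using R hom by (metis range_subsetD)+
  ultimately show ?thesis
    using add mult by (auto simp: is_subfield_def)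
qed


section \<open>Scaling the variables by roots of unity\<close>

text \<open>The value of the monomial \<open>Y\<^sup>e\<close> at \<open>\<omega>\<close>, viewed as a character in \<open>\<omega>\<close>.\<close>

definition character :: "('r::finite \<Rightarrow> 'k::comm_monoid_mult) \<Rightarrow> ('r \<Rightarrow> nat) \<Rightarrow> 'k" where
  "character \<omega> e = (\<Prod>i\<in>UNIV. \<omega> i ^ e i)"

text \<open>The series \<open>f(\<omega>\<^sub>1 Y\<^sub>1, \<dots>, \<omega>\<^sub>r Y\<^sub>r)\<close>.\<close>

definition twist :: "('r::finite \<Rightarrow> 'k::comm_ring_1) \<Rightarrow> ('k, 'r) mfps \<Rightarrow> ('k, 'r) mfps" where
  "twist \<omega> f = Abs_mfps (\<lambda>e. mfps_coeff f e * character \<omega> e)"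

text \<open>The group \<open>\<mu>\<^sub>m\<^sup>r\<close>, with pointwise multiplication.\<close>

definition unity_torus :: "nat \<Rightarrow> ('r::finite \<Rightarrow> 'k::comm_ring_1) set" where
  "unity_torus m = {\<omega>. \<forall>i. \<omega> i ^ m = 1}"

lemma character_add: "character \<omega> (a + b) = character \<omega> a * character \<omega> b"
  by (simp add: character_def power_add prod.distrib)

lemma character_mult: "character (\<omega> * \<tau>) e = character \<omega> e * character \<tau> e"
  by (simp add: character_def power_mult_distrib prod.distrib)

lemma character_unity_torus:
  assumes "\<omega> \<in> unity_torus m"
  shows "character \<omega> (\<lambda>i. m * e i + d i) = character \<omega> d"
  using assms by (simp add: character_def unity_torus_def power_add power_mult)

lemma twist_hom:
  fixes \<omega> :: "'r::finite \<Rightarrow> 'k::comm_ring_1"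
  shows "twist \<omega> 0 = 0" "twist \<omega> 1 = 1" "twist \<omega> (f + g) = twist \<omega> f + twist \<omega> g"
    "twist \<omega> (f * g) = twist \<omega> f * twist \<omega> g"
proof -
  show "twist \<omega> 0 = 0"
    by (rule mfps_eqI) (simp add: twist_def zero_mfps.rep_eq)
  show "twist \<omega> 1 = 1"
    by (rule mfps_eqI) (auto simp: twist_def one_mfps.rep_eq character_def)
  show "twist \<omega> (f + g) = twist \<omega> f + twist \<omega> g"
    by (rule mfps_eqI) (simp add: twist_def plus_mfps.rep_eq distrib_right)
  show "twist \<omega> (f * g) = twist \<omega> f * twist \<omega> g"
  proof (rule mfps_eqI)
    fix e :: "'r \<Rightarrow> nat"
    show "mfps_coeff (twist \<omega> (f * g)) e = mfps_coeff (twist \<omega> f * twist \<omega> g) e"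
      unfolding times_mfps.rep_eq twist_def mfps_coeff_Abs sum_distrib_right
      by (rule sum.cong) (auto simp: splits_def character_add mult_ac)
  qed
qed

lemma twist_prod: "twist \<omega> (prod h A) = (\<Prod>x\<in>A. twist \<omega> (h x))"
  by (induction A rule: infinite_finite_induct) (simp_all add: twist_hom)

lemma twist_twist: "twist \<omega> (twist \<tau> f) = twist (\<omega> * \<tau>) f"
  by (rule mfps_eqI) (simp add: twist_def character_mult mult_ac)

lemma twist_1: "twist 1 f = f"
  by (rule mfps_eqI) (simp add: twist_def character_def)

lemma one_in_unity_torus: "1 \<in> unity_torus m"
  by (simp add: unity_torus_def)

lemma mult_in_unity_torus: "\<omega> \<in> unity_torus m \<Longrightarrow> \<tau> \<in> unity_torus m \<Longrightarrow> \<omega> * \<tau> \<in> unity_torus m"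
  by (simp add: unity_torus_def power_mult_distrib)

lemma finite_unity_torus:
  assumes "m > 0"
  shows "finite (unity_torus m :: ('r::finite \<Rightarrow> 'k::idom) set)"
proof -
  have "(unity_torus m :: ('r \<Rightarrow> 'k) set) \<subseteq> PiE UNIV (\<lambda>_. {x. x ^ m = 1})"
    by (auto simp: unity_torus_def)
  moreover have "finite {x :: 'k. x ^ m = 1}"
  proof -
    have "coeff (monom 1 m - 1 :: 'k poly) m \<noteq> 0"
      using assms by simp
    then have "monom 1 m - 1 \<noteq> (0 :: 'k poly)"
      by (metis coeff_0)
    from poly_roots_finite[OF this] show ?thesis
      by (simp add: poly_monom)
  qed
  ultimately show ?thesis
    by (meson finite_PiE finite_class.finite_UNIV finite_subset)
qed

lemma inj_twist:
  fixes \<omega> :: "'r::finite \<Rightarrow> 'k::idom"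
  assumes "m > 0" "\<omega> \<in> unity_torus m"
  shows "inj (twist \<omega>)"
proof (rule injI)
  fix f g assume eq: "twist \<omega> f = twist \<omega> g"
  have "\<omega> i \<noteq> 0" for i
    using assms by (auto simp: unity_torus_def power_0_left dest: spec[of _ i])
  then have "character \<omega> e \<noteq> 0" for e
    by (simp add: character_def)
  moreover have "mfps_coeff (twist \<omega> f) e = mfps_coeff (twist \<omega> g) e" for e
    by (simp only: eq)
  ultimately show "f = g"
    by (intro mfps_eqI) (simp add: twist_def)
qed

text \<open>
  If \<open>m\<close> does not divide \<open>n\<close>, some \<open>m\<close>-th root of unity has nontrivial \<open>n\<close>-th power. With
  \<open>g = gcd m n\<close> and \<open>m = g t\<close>, any \<open>x\<close> for which \<open>x\<^sup>g\<close> is a root of \<open>1 + z + \<dots> + z\<^bsup>t-1\<^esup>\<close> will do: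
  \<open>x\<^sup>n = 1\<close> would force \<open>x\<^sup>g = 1\<close>, hence \<open>t = 0\<close> in the field.
\<close>

lemma exists_root_of_unity:
  assumes char: "\<not> CHAR('k::alg_closed_field) dvd m" and n: "\<not> m dvd n"
  shows "\<exists>x :: 'k. x ^ m = 1 \<and> x ^ n \<noteq> 1"
proof -
  have m: "m > 0"
    using char by (auto intro!: Nat.gr0I)
  define g where "g = gcd m n"
  obtain t where t: "m = g * t"
    unfolding g_def by (meson dvdE gcd_dvd1)
  have g: "g > 0"
    using m by (simp add: g_def)
  have "t \<noteq> 0"
    using m t by auto
  moreover have "t \<noteq> 1"
  proof
    assume "t = 1"
    then have "m = gcd m n" using t g_def by simp
    then show False using n by (metis gcd_dvd2)
  qed
  ultimately have t1: "t - 1 > 0"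
    by simp
  from alg_closed[OF this, of "\<lambda>_. 1 :: 'k"]
  obtain z :: 'k where "(\<Sum>k\<le>t - 1. z ^ k) = 0"
    by auto
  moreover have "{..t - 1} = {..<t}"
    using t1 by auto
  ultimately have z: "(\<Sum>k<t. z ^ k) = 0"
    by simp
  obtain x where x: "x ^ g = z"
    using nth_root_exists[OF g] by blast
  have "z ^ t - 1 = (z - 1) * (\<Sum>k<t. z ^ k)"
    by (rule power_diff_1_eq)
  with z have zt: "z ^ t = 1"
    by simp
  have xm: "x ^ m = 1"
    by (simp add: t power_mult x zt)
  moreover have "x ^ n \<noteq> 1"
  proof
    assume xn: "x ^ n = 1"
    obtain a b where "m * a = n * b + g"
      using bezout_nat[of m n] m by (auto simp: g_def)
    then have "(x ^ m) ^ a = (x ^ n) ^ b * x ^ g"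
      by (simp flip: power_mult power_add)
    then have "z = 1"
      using xm xn x by simp
    with z have "of_nat t = (0 :: 'k)"
      by simp
    then have "CHAR('k) dvd t"
      by (simp add: of_nat_eq_0_iff_char_dvd)
    with char t show False
      by simp
  qed
  ultimately show ?thesis
    by blast
qed

lemma twist_invariant_imp_subst_power:
  fixes f :: "('k::alg_closed_field, 'r::finite) mfps"
  assumes char: "\<not> CHAR('k) dvd m" and inv: "\<And>\<omega>. \<omega> \<in> unity_torus m \<Longrightarrow> twist \<omega> f = f"
  shows "f \<in> range (subst_power m)"
proof -
  have m: "m > 0"
    using char by (auto intro!: Nat.gr0I)
  have dvd: "m dvd e i" if nz: "mfps_coeff f e \<noteq> 0" for e i
  proof (rule ccontr)
    assume "\<not> m dvd e i"
    from exists_root_of_unity[OF char this]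
    obtain x :: 'k where x: "x ^ m = 1" "x ^ e i \<noteq> 1"
      by blast
    define \<omega> where "\<omega> = (\<lambda>j. if j = i then x else 1)"
    have "\<omega> \<in> unity_torus m"
      using x by (simp add: unity_torus_def \<omega>_def)
    then have "mfps_coeff f e * character \<omega> e = mfps_coeff f e"
      using inv by (metis mfps_coeff_Abs twist_def)
    with nz have "character \<omega> e = 1"
      by simp
    moreover have "character \<omega> e = (\<Prod>j\<in>UNIV. if j = i then x ^ e j else 1)"
      unfolding character_def \<omega>_def by (rule prod.cong) auto
    ultimately show False
      using x by simp
  qed
  have "f = subst_power m (Abs_mfps (\<lambda>e. mfps_coeff f (\<lambda>i. m * e i)))"
    by (rule mfps_eqI) (use dvd in \<open>auto simp: subst_power_def\<close>)
  then show ?thesis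
    by blast
qed


section \<open>Monomials of a Puiseux power series\<close>

lemma puiseux_eq_0_iff:
  fixes \<iota> :: "('k::alg_closed_field, 'r::finite) mfps fract \<Rightarrow> 'c::field"
  assumes \<iota>: "field_embedding \<iota>" and \<rho>: "compatible_roots \<iota> \<rho>" and char: "\<not> CHAR('k) dvd m"
  shows "puiseux \<iota> \<rho> m f = 0 \<longleftrightarrow> f = 0"
proof
  have m: "m > 0"
    using char by (auto intro!: Nat.gr0I)
  note P = \<iota> \<rho> m
  assume 0: "puiseux \<iota> \<rho> m f = 0"
  show "f = 0"
  proof (rule ccontr)
    assume nz: "f \<noteq> 0"
    let ?G = "unity_torus m :: ('r \<Rightarrow> 'k) set"
    have fin: "finite ?G"
      by (rule finite_unity_torus[OF m])
    \<comment> \<open>The norm of \<open>f\<close>: invariant, nonzero, and a multiple of \<open>f\<close>.\<close>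
    define N where "N = (\<Prod>\<omega>\<in>?G. twist \<omega> f)"
    have "N \<in> range (subst_power m)"
    proof (rule twist_invariant_imp_subst_power[OF char])
      fix \<tau> :: "'r \<Rightarrow> 'k" assume \<tau>: "\<tau> \<in> unity_torus m"
      have "\<tau> i \<noteq> 0" for i
        using \<tau> m by (auto simp: unity_torus_def power_0_left dest: spec[of _ i])
      then have inj: "inj_on ((*) \<tau>) ?G"
        by (auto simp: inj_on_def fun_eq_iff)
      then have "(*) \<tau> ` ?G = ?G"
        using \<tau> by (intro endo_inj_surj fin) (auto intro: mult_in_unity_torus)
      with inj have "bij_betw ((*) \<tau>) ?G ?G"
        by (simp add: bij_betw_def)
      then show "twist \<tau> N = N"
        unfolding N_def twist_prod twist_twist by (rule prod.reindex_bij_betw)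
    qed
    then obtain n where n: "N = subst_power m n"
      by blast
    have "twist \<omega> f \<noteq> 0" if "\<omega> \<in> ?G" for \<omega>
      using inj_twist[OF m that] nz twist_hom(1) by (metis injD)
    then have "N \<noteq> 0"
      unfolding N_def using fin by simp
    then have "n \<noteq> 0"
      using n by (auto simp: subst_power_def mfps_eqI zero_mfps.rep_eq)
    have "N = f * (\<Prod>\<omega>\<in>?G - {1}. twist \<omega> f)"
      unfolding N_def by (subst prod.remove[OF fin one_in_unity_torus]) (simp add: twist_1)
    then have "puiseux \<iota> \<rho> m N = 0"
      using 0 by (simp add: puiseux_mult[OF P])
    then have "\<iota> (to_fract n) = 0"
      unfolding n puiseux_subst_power[OF P] .
    moreover have "\<iota> (to_fract n) * \<iota> (inverse (to_fract n)) = 1"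
      using \<iota> \<open>n \<noteq> 0\<close> unfolding field_embedding_def by (metis right_inverse to_fract_eq_0_iff)
    ultimately show False
      by simp
  qed
qed (use puiseux_0[OF \<iota> \<rho>] char in \<open>auto intro!: puiseux_0 \<iota> \<rho> Nat.gr0I\<close>)

lemma root_monom_in_subfield:
  fixes \<iota> :: "('k::alg_closed_field, 'r::finite) mfps fract \<Rightarrow> 'c::field"
  assumes \<iota>: "field_embedding \<iota>" and \<rho>: "compatible_roots \<iota> \<rho>" and char: "\<not> CHAR('k) dvd m"
    and E: "is_subfield E" "range \<iota> \<subseteq> E" and f: "puiseux \<iota> \<rho> m f \<in> E"
    and d: "residue_part m d f \<noteq> 0"
  shows "root_monom \<rho> m d \<in> E"
proof -
  have m: "m > 0"
    using char by (auto intro!: Nat.gr0I)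
  note P = \<iota> \<rho> m
  let ?G = "unity_torus m :: ('r \<Rightarrow> 'k) set"
  let ?y = "mfps_monom d :: ('k, 'r) mfps"
  define V where "V = (\<lambda>\<omega>. twist \<omega> f) ` ?G"
  define h where "h v = twist (SOME \<omega>. \<omega> \<in> ?G \<and> twist \<omega> f = v) ?y" for v
  have finV: "finite V"
    unfolding V_def by (intro finite_imageI finite_unity_torus m)
  obtain e where "mfps_coeff (residue_part m d f) e \<noteq> 0"
    using d by (metis mfps_eqI zero_mfps.rep_eq)
  then have e: "mfps_coeff f (\<lambda>i. m * e i + d i) \<noteq> 0"
    by (simp add: residue_part_def)
  \<comment> \<open>The map \<open>\<omega> f \<mapsto> \<omega> Y\<^sup>d\<close> is well defined, since \<open>\<omega> f\<close> determines the value of \<open>\<omega>\<close> at \<open>d\<close>.\<close>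
  have well_def: "twist \<omega> ?y = twist \<tau> ?y"
    if "\<omega> \<in> ?G" "\<tau> \<in> ?G" "twist \<omega> f = twist \<tau> f" for \<omega> \<tau>
  proof -
    have "mfps_coeff (twist \<omega> f) (\<lambda>i. m * e i + d i) = mfps_coeff (twist \<tau> f) (\<lambda>i. m * e i + d i)"
      by (simp only: that(3))
    with e have "character \<omega> (\<lambda>i. m * e i + d i) = character \<tau> (\<lambda>i. m * e i + d i)"
      by (simp add: twist_def)
    then have "character \<omega> d = character \<tau> d"
      using that by (simp add: character_unity_torus)
    then show ?thesis
      by (intro mfps_eqI) (simp add: twist_def mfps_monom_def)
  qed
  have h: "h (twist \<omega> f) = twist \<omega> ?y" if "\<omega> \<in> ?G" for \<omega>
  proof -
    let ?\<tau> = "SOME \<tau>. \<tau> \<in> ?G \<and> twist \<tau> f = twist \<omega> f"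
    have "?\<tau> \<in> ?G \<and> twist ?\<tau> f = twist \<omega> f"
      by (rule someI[of _ \<omega>]) (use that in simp)
    then show ?thesis
      unfolding h_def using that by (intro well_def) auto
  qed
  have fV: "f \<in> V"
    unfolding V_def using one_in_unity_torus twist_1 by (metis image_eqI)
  have hf: "h f = ?y"
    using h[OF one_in_unity_torus] by (simp add: twist_1)
  have in_E: "puiseux \<iota> \<rho> m (poly (lagrange_numerator V q) f) \<in> E"
    if q: "\<And>\<omega> v. \<omega> \<in> ?G \<Longrightarrow> v \<in> V \<Longrightarrow> twist \<omega> (q v) = q (twist \<omega> v)" for q
  proof -
    have coeff: "puiseux \<iota> \<rho> m (coeff (lagrange_numerator V q) n) \<in> E" for n
    proof -
      have "coeff (lagrange_numerator V q) n \<in> range (subst_power m)"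
      proof (rule twist_invariant_imp_subst_power[OF char])
        fix \<omega> :: "'r \<Rightarrow> 'k" assume \<omega>: "\<omega> \<in> unity_torus m"
        have inj: "inj_on (twist \<omega>) V"
          using inj_twist[OF m \<omega>] by (rule inj_on_subset) simp
        moreover have "twist \<omega> ` V \<subseteq> V"
          unfolding V_def using \<omega> by (auto simp: twist_twist intro: mult_in_unity_torus)
        ultimately have "bij_betw (twist \<omega>) V V"
          using endo_inj_surj[OF finV] by (simp add: bij_betw_def)
        then have "map_poly (twist \<omega>) (lagrange_numerator V q) = lagrange_numerator V q"
          by (intro map_poly_lagrange_numerator twist_hom q \<omega>)
        then show "twist \<omega> (coeff (lagrange_numerator V q) n) = coeff (lagrange_numerator V q) n"
          using coeff_map_poly[of "twist \<omega>"] twist_hom(1) by metis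
      qed
      then show ?thesis
        using E(2) puiseux_subst_power[OF P] by auto
    qed
    have "puiseux \<iota> \<rho> m (f ^ n) = puiseux \<iota> \<rho> m f ^ n" for n
      by (induction n) (simp_all add: puiseux_1[OF P] puiseux_mult[OF P])
    then show ?thesis
      unfolding poly_altdef puiseux_sum[OF P] puiseux_mult[OF P]
      using f coeff by (auto intro!: subfield_sum subfield_mult subfield_power E(1))
  qed
  define w where "w = (\<Prod>v\<in>V - {f}. f - v)"
  have num: "puiseux \<iota> \<rho> m (?y * w) \<in> E"
  proof -
    have "twist \<omega> (h v) = h (twist \<omega> v)" if "\<omega> \<in> ?G" "v \<in> V" for \<omega> v
      using that by (auto simp: V_def h twist_twist mult_in_unity_torus)
    from in_E[of h, OF this] show ?thesis
      by (simp add: poly_lagrange_numerator[OF finV fV] hf w_def)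
  qed
  have den: "puiseux \<iota> \<rho> m w \<in> E"
    using in_E[of "\<lambda>_. 1"] by (simp add: poly_lagrange_numerator[OF finV fV] twist_hom w_def)
  have "w \<noteq> 0"
    unfolding w_def using finV by auto
  then have "puiseux \<iota> \<rho> m w \<noteq> 0"
    by (simp add: puiseux_eq_0_iff[OF \<iota> \<rho> char])
  then have "root_monom \<rho> m d = puiseux \<iota> \<rho> m (?y * w) / puiseux \<iota> \<rho> m w"
    by (simp add: puiseux_mult[OF P] puiseux_monom[OF P])
  then show ?thesis
    using num den subfield_divide[OF E(1)] by simp
qed


section \<open>Generation by monomials and by one Puiseux power series\<close>

text \<open>
  Exponents are taken modulo \<open>m\<close>: the condition \<open>residue_part m d f \<noteq> 0\<close> says that some monomial
  with exponent congruent to \<open>d\<close> occurs in \<open>f\<close>.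
\<close>

lemma ring_adjoin_puiseux_eq_field_adjoin:
  fixes \<iota> :: "('k::alg_closed_field, 'r::finite) mfps fract \<Rightarrow> 'c::alg_closed_field"
  assumes closure: "algebraic_closure_embedding \<iota>" and \<rho>: "compatible_roots \<iota> \<rho>"
    and char: "\<not> CHAR('k) dvd m"
  shows "ring_adjoin \<iota> (puiseux \<iota> \<rho> m f) =
    field_adjoin \<iota> (root_monom \<rho> m ` {d. (\<forall>i. d i < m) \<and> residue_part m d f \<noteq> 0})"
    (is "?R = field_adjoin \<iota> ?P")
proof
  have \<iota>: "field_embedding \<iota>" and alg: "\<And>\<alpha>. algebraic_elem \<iota> \<alpha>"
    using closure by (auto simp: algebraic_closure_embedding_def)
  let ?F = "field_adjoin \<iota> ?P"
  note F = is_subfield_field_adjoin[of \<iota> ?P] field_adjoin_superset[where \<iota> = \<iota> and P = ?P]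
  show "?F \<subseteq> ?R"
  proof (intro field_adjoin_least is_subfield_ring_adjoin \<iota> alg ring_adjoin_superset)
    show "?P \<subseteq> ?R"
      using root_monom_in_subfield[OF \<iota> \<rho> char is_subfield_ring_adjoin[OF \<iota> alg] ring_adjoin_superset[OF \<iota>]]
      by blast
  qed
  have "puiseux \<iota> \<rho> m f \<in> ?F"
    unfolding puiseux_def
  proof (rule subfield_sum[OF F(1)])
    fix d :: "'r \<Rightarrow> nat" assume d: "d \<in> {d. \<forall>i. d i < m}"
    show "\<iota> (to_fract (residue_part m d f)) * root_monom \<rho> m d \<in> ?F"
    proof (cases "residue_part m d f = 0")
      case True
      then show ?thesis
        using F(1) by (simp add: field_embedding_0[OF \<iota>] is_subfield_def)
    next
      case False
      then have "root_monom \<rho> m d \<in> ?F"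
        using d F(3) by blast
      then show ?thesis
        using F(2) by (intro subfield_mult F(1)) auto
    qed
  qed
  then show "?R \<subseteq> ?F"
    by (intro ring_adjoin_subset_subfield \<iota> F)
qed

text \<open>
  A monomial generates the same extension of \<open>K\<close> as the monomial with exponents reduced modulo
  \<open>m\<close>, as the two differ by a nonzero monomial in \<open>X\<^sub>1, \<dots>, X\<^sub>r\<close>.
\<close>

lemma root_monom_mod:
  fixes \<iota> :: "('k::idom, 'r::finite) mfps fract \<Rightarrow> 'c::field"
  assumes \<iota>: "field_embedding \<iota>" and \<rho>: "compatible_roots \<iota> \<rho>" and m: "m > 0"
    and E: "is_subfield E" "range \<iota> \<subseteq> E"
  shows "root_monom \<rho> m e \<in> E \<longleftrightarrow> root_monom \<rho> m (\<lambda>i. e i mod m) \<in> E"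
proof -
  note P = \<iota> \<rho> m
  define x where "x = to_fract (mfps_monom (\<lambda>i. e i div m) :: ('k, 'r) mfps)"
  have "mfps_coeff (mfps_monom a :: ('k, 'r) mfps) a \<noteq> 0" for a
    by (simp add: mfps_monom_def)
  then have "(mfps_monom a :: ('k, 'r) mfps) \<noteq> 0" for a
    by (metis zero_mfps.rep_eq)
  then have "x \<noteq> 0"
    by (simp add: x_def)
  then have "\<iota> x * \<iota> (inverse x) = 1"
    using \<iota> unfolding field_embedding_def by (metis right_inverse)
  then have nz: "\<iota> x \<noteq> 0"
    by auto
  have "(mfps_monom e :: ('k, 'r) mfps) =
      subst_power m (mfps_monom (\<lambda>i. e i div m)) * mfps_monom (\<lambda>i. e i mod m)"
  proof -
    have "e = (\<lambda>i. m * (e i div m)) + (\<lambda>i. e i mod m)"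
      by (simp add: fun_eq_iff)
    moreover have "(mfps_monom (\<lambda>i. m * a i) :: ('k, 'r) mfps) = subst_power m (mfps_monom a)" for a
    proof (rule mfps_eqI)
      fix e :: "'r \<Rightarrow> nat"
      have "e = (\<lambda>i. m * a i) \<longleftrightarrow> (\<forall>i. m dvd e i) \<and> (\<lambda>i. e i div m) = a"
        using m by (auto simp: fun_eq_iff) (metis dvd_mult_div_cancel)
      then show "mfps_coeff (mfps_monom (\<lambda>i. m * a i) :: ('k, 'r) mfps) e =
          mfps_coeff (subst_power m (mfps_monom a)) e"
        by (simp add: mfps_monom_def subst_power_def)
    qed
    ultimately show ?thesis
      by (metis mfps_monom_add)
  qed
  then have eq: "root_monom \<rho> m e = \<iota> x * root_monom \<rho> m (\<lambda>i. e i mod m)"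
    by (metis P puiseux_monom puiseux_subst_power_mult x_def)
  have x: "\<iota> x \<in> E"
    using E(2) by auto
  show ?thesis
  proof
    assume "root_monom \<rho> m e \<in> E"
    then have "root_monom \<rho> m e / \<iota> x \<in> E"
      by (intro subfield_divide E x)
    then show "root_monom \<rho> m (\<lambda>i. e i mod m) \<in> E"
      using nz by (simp add: eq)
  qed (simp add: eq subfield_mult[OF E(1) x])
qed

theorem mainTheorem1:
  fixes \<iota> :: "('k::alg_closed_field, 'r::finite) mfps fract \<Rightarrow> 'c::alg_closed_field"
    and \<rho> :: "'r \<Rightarrow> nat \<Rightarrow> 'c"
    and K' :: "'c set"
  assumes "algebraic_closure_embedding \<iota>"
    and "compatible_roots \<iota> \<rho>"
    and "algebraic_separable_extension \<iota> K'"
  shows "(\<exists>m>0. \<not> CHAR('k) dvd m \<and>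
            (\<exists>P. P \<subseteq> range (root_monom \<rho> m) \<and> K' = field_adjoin \<iota> P)) \<longleftrightarrow>
         (\<exists>m>0. \<not> CHAR('k) dvd m \<and>
            (\<exists>\<zeta>\<in>puiseux_ring \<iota> \<rho> m. K' = ring_adjoin \<iota> \<zeta>))"
proof
  assume "\<exists>m>0. \<not> CHAR('k) dvd m \<and> (\<exists>\<zeta>\<in>puiseux_ring \<iota> \<rho> m. K' = ring_adjoin \<iota> \<zeta>)"
  then obtain m \<zeta> where m: "m > 0" "\<not> CHAR('k) dvd m"
    and \<zeta>: "\<zeta> \<in> puiseux_ring \<iota> \<rho> m" "K' = ring_adjoin \<iota> \<zeta>"
    by blast
  from \<zeta>(1) obtain f where "\<zeta> = puiseux \<iota> \<rho> m f"
    unfolding puiseux_ring_def by (rule rangeE)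
  with \<zeta>(2) have K': "K' = field_adjoin \<iota> (root_monom \<rho> m ` {d. (\<forall>i. d i < m) \<and> residue_part m d f \<noteq> 0})"
    by (simp only: ring_adjoin_puiseux_eq_field_adjoin[OF assms(1,2) m(2)])
  show "\<exists>m>0. \<not> CHAR('k) dvd m \<and> (\<exists>P. P \<subseteq> range (root_monom \<rho> m) \<and> K' = field_adjoin \<iota> P)"
    using m K' by (intro exI[of _ m] conjI exI[of _ "root_monom \<rho> m ` _"] image_mono) auto
next
  assume "\<exists>m>0. \<not> CHAR('k) dvd m \<and> (\<exists>P. P \<subseteq> range (root_monom \<rho> m) \<and> K' = field_adjoin \<iota> P)"
  then obtain m P where m: "m > 0" "\<not> CHAR('k) dvd m"
    and P: "P \<subseteq> range (root_monom \<rho> m)" and K': "K' = field_adjoin \<iota> P"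
    by blast
  have \<iota>: "field_embedding \<iota>"
    using assms(1) by (simp add: algebraic_closure_embedding_def)
  note mod = root_monom_mod[OF \<iota> assms(2) m(1)]
  have field: "is_subfield K'" "range \<iota> \<subseteq> K'" "P \<subseteq> K'"
    unfolding K' by (rule is_subfield_field_adjoin field_adjoin_superset)+
  \<comment> \<open>The primitive element is the sum of all reduced monomials in \<open>K'\<close>, so no cancellation occurs.\<close>
  define D where "D = {d. (\<forall>i. d i < m) \<and> root_monom \<rho> m d \<in> K'}"
  have fin: "finite D"
    by (rule finite_subset[OF _ finite_residues[of m]]) (auto simp: D_def)
  define f :: "('k, 'r) mfps" where "f = (\<Sum>d\<in>D. mfps_monom d)"
  have coeff_f: "mfps_coeff f e = (if e \<in> D then 1 else 0)" for e
    using fin by (simp add: f_def mfps_coeff_sum mfps_monom_def)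
  have residue: "residue_part m d f \<noteq> 0 \<longleftrightarrow> d \<in> D" if d: "\<forall>i. d i < m" for d
  proof
    assume "d \<in> D"
    then have "mfps_coeff (residue_part m d f) 0 = 1"
      by (simp add: residue_part_def coeff_f)
    then show "residue_part m d f \<noteq> 0"
      by (auto simp: zero_mfps.rep_eq)
  next
    assume "residue_part m d f \<noteq> 0"
    then obtain e where "mfps_coeff (residue_part m d f) e \<noteq> 0"
      by (metis mfps_eqI zero_mfps.rep_eq)
    then have "(\<lambda>i. m * e i + d i) \<in> D"
      by (simp add: residue_part_def coeff_f split: if_splits)
    then have "root_monom \<rho> m (\<lambda>i. m * e i + d i) \<in> K'"
      by (simp add: D_def)
    then show "d \<in> D"
      using d mod[OF field(1,2), of "\<lambda>i. m * e i + d i"] by (simp add: D_def)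
  qed
  have "{d. (\<forall>i. d i < m) \<and> residue_part m d f \<noteq> 0} = D"
    using residue by (auto simp: D_def)
  then have R: "ring_adjoin \<iota> (puiseux \<iota> \<rho> m f) = field_adjoin \<iota> (root_monom \<rho> m ` D)"
    using ring_adjoin_puiseux_eq_field_adjoin[OF assms(1,2) m(2), of f] by simp
  note F = is_subfield_field_adjoin[of \<iota> "root_monom \<rho> m ` D"]
    field_adjoin_superset[where \<iota> = \<iota> and P = "root_monom \<rho> m ` D"]
  have "P \<subseteq> field_adjoin \<iota> (root_monom \<rho> m ` D)"
  proof
    fix x assume x: "x \<in> P"
    then obtain e where e: "x = root_monom \<rho> m e"
      using P by blast
    have "root_monom \<rho> m (\<lambda>i. e i mod m) \<in> K'"
      using x e field(3) mod[OF field(1,2)] by blast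
    then have "(\<lambda>i. e i mod m) \<in> D"
      using m by (simp add: D_def)
    then show "x \<in> field_adjoin \<iota> (root_monom \<rho> m ` D)"
      using mod[OF F(1,2)] F(3) e by blast
  qed
  then have "K' \<subseteq> ring_adjoin \<iota> (puiseux \<iota> \<rho> m f)"
    unfolding R by (subst K') (intro field_adjoin_least F)
  moreover have "ring_adjoin \<iota> (puiseux \<iota> \<rho> m f) \<subseteq> K'"
    unfolding R by (intro field_adjoin_least field) (auto simp: D_def)
  ultimately have "K' = ring_adjoin \<iota> (puiseux \<iota> \<rho> m f)"
    by (rule subset_antisym)
  moreover have "puiseux \<iota> \<rho> m f \<in> puiseux_ring \<iota> \<rho> m"
    by (simp add: puiseux_ring_def)
  ultimately show "\<exists>m>0. \<not> CHAR('k) dvd m \<and> (\<exists>\<zeta>\<in>puiseux_ring \<iota> \<rho> m. K' = ring_adjoin \<iota> \<zeta>)"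
    using m by blast
qed

end
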